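(* Let $L>0$ and suppose that $F:\mathbb{R}^d\rightarrow\mathbb{R}$ is (possibly non-convex) $L$-smooth. Then for any $x,x^+\in\mathbb{R}^d$ with $x^+=x-\gamma Q_{T,p}(\nabla F(x))$, where $Q_{T,p}$ is the stochastic sparsifier and $\gamma=\omega_p(T)/L$, we have $$\mathbf{E}F(x^+)\leq\mathbf{E}F(x)-\frac{\omega_p(T)}{2L}\mathbf{E}\|\nabla F(x)\|^2,\qquad\text{where}\qquad \omega_p(T)=\frac{\|\nabla F(x)\|^2}{\mathbf{E}\|Q_{T,p}(\nabla F(x))\|^2}.$$
   Context: $\|\cdot\|$ is the Euclidean norm. A continuously differentiable $F:\mathbb{R}^d\to\mathbb{R}$ is $L$-smooth if $\|\nabla F(x)-\nabla F(y)\|\le L\|x-y\|$ for all $x,y\in\mathbb{R}^d$. For $g\in\mathbb{R}^d$ and probabilities $p=(p_1,\ldots,p_d)\in[0,1]^d$ with $\sum_{j=1}^d p_j=T$ and $p_j>0$ whenever $g_j\neq0$, the stochastic sparsifier is the random vector $[Q_{T,p}(g)]_j=(g_j/p_j)\,b_j$ with $b_j\sim\mathrm{Bernoulli}(p_j)$ (and $[Q_{T,p}(g)]_j=0$ if $g_j=0$). The expectation $\mathbf{E}$ is over the randomness of the sparsifier; the ratio $\omega_p(T)$ (which depends on $x$) is understood at points with $\nabla F(x)\neq0$. *)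

theory Defs
  imports "HOL-Probability.Probability"
begin

definition grad :: "('a::real_inner \<Rightarrow> real) \<Rightarrow> 'a \<Rightarrow> 'a" where
  "grad F x = (THE g. GDERIV F x :> g)"

lemma grad_eqI:
  assumes "GDERIV F x :> g"
  shows "grad F x = g"
  unfolding grad_def
proof (rule the_equality)
  show "GDERIV F x :> g" by (fact assms)
next
  fix h assume "GDERIV F x :> h"
  then have "(\<lambda>v. v \<bullet> h) = (\<lambda>v. v \<bullet> g)"
    using assms unfolding gderiv_def by (rule has_derivative_unique)
  then have "v \<bullet> h = v \<bullet> g" for v
    by (rule fun_cong)
  then have "(h - g) \<bullet> (h - g) = 0"
    by (simp add: inner_diff_right)
  then show "h = g" by simp
qed

lemma GDERIV_grad:
  fixes F :: "'a::euclidean_space \<Rightarrow> real"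
  assumes "F differentiable (at x)"
  shows "GDERIV F x :> grad F x"
proof -
  obtain F' where F': "(F has_derivative F') (at x)"
    using assms unfolding differentiable_def by blast
  interpret linear F' using F' by (rule has_derivative_linear)
  let ?g = "\<Sum>i\<in>Basis. F' i *\<^sub>R i"
  have "F' h = h \<bullet> ?g" for h
  proof -
    have "F' h = F' (\<Sum>i\<in>Basis. (h \<bullet> i) *\<^sub>R i)"
      by (simp add: euclidean_representation)
    also have "\<dots> = h \<bullet> ?g"
      by (simp add: sum scale inner_sum_right mult.commute)
    finally show ?thesis .
  qed
  then have "F' = (\<lambda>h. h \<bullet> ?g)" by (rule ext)
  with F' have "GDERIV F x :> ?g" by (simp add: gderiv_def)
  then show ?thesis using grad_eqI by metis
qed

definition L_smooth :: "real \<Rightarrow> ('a::euclidean_space \<Rightarrow> real) \<Rightarrow> bool" where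
  "L_smooth L F \<longleftrightarrow>
     (\<forall>x. F differentiable (at x)) \<and> continuous_on UNIV (grad F) \<and>
     (\<forall>x y. norm (grad F x - grad F y) \<le> L * norm (x - y))"

definition valid_probs :: "real \<Rightarrow> real ^ 'n \<Rightarrow> real ^ 'n \<Rightarrow> bool" where
  "valid_probs T p g \<longleftrightarrow>
     (\<forall>j. 0 \<le> p $ j \<and> p $ j \<le> 1) \<and> (\<Sum>j\<in>UNIV. p $ j) = T \<and>
     (\<forall>j. g $ j \<noteq> 0 \<longrightarrow> 0 < p $ j)"

text \<open>Only the marginal laws of the selectors are prescribed; in particular they need not be
  independent.\<close>

definition bernoulli_selectors ::
    "'w measure \<Rightarrow> real ^ 'n \<Rightarrow> ('n \<Rightarrow> 'w \<Rightarrow> bool) \<Rightarrow> bool" where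
  "bernoulli_selectors M p b \<longleftrightarrow>
     (\<forall>j. b j \<in> measurable M (count_space UNIV) \<and>
          distr M (count_space UNIV) (b j) = measure_pmf (bernoulli_pmf (p $ j)))"

text \<open>The budget \<open>T\<close> enters the sparsifier only through the constraint on \<open>p\<close>.\<close>

definition sparsifier ::
    "real ^ 'n \<Rightarrow> ('n \<Rightarrow> 'w \<Rightarrow> bool) \<Rightarrow> real ^ 'n \<Rightarrow> 'w \<Rightarrow> real ^ 'n" where
  "sparsifier p b g w = (\<chi> j. if g $ j = 0 then 0 else g $ j / p $ j * of_bool (b j w))"

definition sparsity_ratio ::
    "'w measure \<Rightarrow> real ^ 'n \<Rightarrow> ('n \<Rightarrow> 'w \<Rightarrow> bool) \<Rightarrow> real ^ 'n \<Rightarrow> real" where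
  "sparsity_ratio M p b g =
     (norm g)\<^sup>2 / prob_space.expectation M (\<lambda>w. (norm (sparsifier p b g w))\<^sup>2)"

text \<open>Every real function of the sparsified vector is integrable, so expectations of such
  functions are never the default value of an undefined integral.\<close>

lemma integrable_sparsifier:
  fixes f :: "real ^ 'n \<Rightarrow> real"
  assumes "prob_space M" and "bernoulli_selectors M p b"
  shows "integrable M (\<lambda>w. f (sparsifier p b g w))"
proof -
  interpret prob_space M by fact
  let ?h = "\<lambda>\<beta>::'n \<Rightarrow> bool. f (\<chi> j. if g $ j = 0 then 0 else g $ j / p $ j * of_bool (\<beta> j))"
  have b: "b j \<in> measurable M (count_space UNIV)" for j
    using assms(2) by (simp add: bernoulli_selectors_def)
  have "(\<lambda>w j. b j w) \<in> measurable M (count_space UNIV)"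
  proof (subst measurable_count_space_eq2, simp, intro conjI ballI)
    show "(\<lambda>w j. b j w) \<in> space M \<rightarrow> UNIV" by simp
  next
    fix \<beta> :: "'n \<Rightarrow> bool"
    have "(\<lambda>w j. b j w) -` {\<beta>} \<inter> space M = (\<Inter>j. b j -` {\<beta> j} \<inter> space M)"
      by (auto simp: fun_eq_iff)
    also have "\<dots> \<in> sets M"
      by (rule sets.finite_INT) (auto intro: measurable_sets[OF b])
    finally show "(\<lambda>w j. b j w) -` {\<beta>} \<inter> space M \<in> sets M" .
  qed
  then have "(\<lambda>w. ?h (\<lambda>j. b j w)) \<in> borel_measurable M"
    by (rule measurable_compose) simp
  moreover have "AE w in M. norm (?h (\<lambda>j. b j w)) \<le> Max (range (\<lambda>\<beta>. norm (?h \<beta>)))"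
    by (intro always_eventually allI Max_ge) auto
  ultimately show ?thesis
    unfolding sparsifier_def by (intro integrable_const_bound)
qed

end

theory Submission
  imports Defs
begin

text \<open>Write \<open>g = grad F x\<close>, let \<open>Q\<close> be the sparsified gradient and let \<open>S\<close> be the expectation of
  \<open>\<parallel>Q\<parallel>\<^sup>2\<close>. By smoothness, \<open>F\<close> lies below a quadratic with curvature \<open>L\<close> that touches it at \<open>x\<close>
  (\<open>L_smooth_quadratic_upper_bound\<close>), hence for every outcome
  \<open>F (x - \<gamma> Q) \<le> F x - \<gamma> (g \<bullet> Q) + L \<gamma>\<^sup>2 / 2 * \<parallel>Q\<parallel>\<^sup>2\<close>.
  The factors \<open>1 / p $ j\<close> make the sparsifier unbiased, so \<open>g \<bullet> Q\<close> has expectation \<open>\<parallel>g\<parallel>\<^sup>2\<close>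
  (\<open>expectation_inner_sparsifier\<close>) and the expected bound is
  \<open>F x - \<gamma> \<parallel>g\<parallel>\<^sup>2 + L \<gamma>\<^sup>2 / 2 * S\<close>. This quadratic in \<open>\<gamma>\<close> is smallest at \<open>\<gamma> = \<parallel>g\<parallel>\<^sup>2 / (L S)\<close>,
  which is the prescribed step size, and its minimum is the claimed bound.\<close>

text \<open>Along the segment from \<open>x\<close> to \<open>x + d\<close> the gradient at parameter \<open>t\<close> differs from that at \<open>x\<close>
  by at most \<open>L t \<parallel>d\<parallel>\<close>, so the difference of the two sides, as a function of \<open>t\<close>, has nonpositive
  derivative.\<close>

lemma L_smooth_quadratic_upper_bound:
  fixes F :: "'a::euclidean_space \<Rightarrow> real"
  assumes "L_smooth L F"
  shows "F (x + d) \<le> F x + grad F x \<bullet> d + L / 2 * (norm d)\<^sup>2"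
proof -
  define \<phi> where "\<phi> t = F (x + t *\<^sub>R d) - t * (grad F x \<bullet> d) - L / 2 * t\<^sup>2 * (norm d)\<^sup>2" for t :: real
  have "\<phi> 1 \<le> \<phi> 0"
  proof (rule DERIV_nonpos_imp_nonincreasing[of 0 1 \<phi>])
    fix t :: real
    assume t: "0 \<le> t" "t \<le> 1"
    define g where "g = grad F (x + t *\<^sub>R d)"
    have F': "(F has_derivative (\<lambda>h. h \<bullet> g)) (at (x + t *\<^sub>R d))"
      using GDERIV_grad[of F "x + t *\<^sub>R d"] assms
      by (simp add: L_smooth_def gderiv_def g_def)
    have "((\<lambda>s. x + s *\<^sub>R d) has_derivative (\<lambda>s. s *\<^sub>R d)) (at t)"
      by (auto intro!: derivative_eq_intros)
    from has_derivative_compose[OF this F']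
    have "((\<lambda>s. F (x + s *\<^sub>R d)) has_real_derivative g \<bullet> d) (at t)"
      by (simp add: has_field_derivative_def mult_commute_abs inner_commute)
    then have "(\<phi> has_real_derivative g \<bullet> d - grad F x \<bullet> d - L * t * (norm d)\<^sup>2) (at t)"
      unfolding \<phi>_def by (auto intro!: derivative_eq_intros)
    moreover have "g \<bullet> d - grad F x \<bullet> d \<le> L * t * (norm d)\<^sup>2"
    proof -
      have "g \<bullet> d - grad F x \<bullet> d \<le> norm (g - grad F x) * norm d"
        using norm_cauchy_schwarz[of "g - grad F x" d] by (simp add: inner_diff_left)
      also have "\<dots> \<le> L * norm (t *\<^sub>R d) * norm d"
        using assms unfolding L_smooth_def g_def
        by (metis add_diff_cancel_left' mult_right_mono norm_ge_zero)
      also have "\<dots> = L * t * (norm d)\<^sup>2"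
        using t by (simp add: power2_eq_square)
      finally show ?thesis .
    qed
    ultimately show "\<exists>y. (\<phi> has_real_derivative y) (at t) \<and> y \<le> 0"
      by (intro exI[of _ "g \<bullet> d - grad F x \<bullet> d - L * t * (norm d)\<^sup>2"]) simp
  qed simp
  then show ?thesis
    by (simp add: \<phi>_def)
qed

lemma expectation_bernoulli_selector:
  assumes "valid_probs T p g" and "bernoulli_selectors M p b"
  shows "(\<integral>w. of_bool (b j w) \<partial>M) = p $ j"
proof -
  have b: "b j \<in> measurable M (count_space UNIV)"
    and law: "distr M (count_space UNIV) (b j) = measure_pmf (bernoulli_pmf (p $ j))"
    using assms(2) by (auto simp: bernoulli_selectors_def)
  have "(\<integral>w. of_bool (b j w) \<partial>M) = (\<integral>c. of_bool c \<partial>distr M (count_space UNIV) (b j) :: real)"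
    by (rule integral_distr[symmetric, OF b]) simp
  also have "\<dots> = p $ j"
    using assms(1) by (simp add: law valid_probs_def)
  finally show ?thesis .
qed

text \<open>Unbiasedness of the sparsifier, in the only form in which the expected decrease needs it:
  each kept entry is scaled by \<open>1 / p $ j\<close>, which cancels the probability of keeping it.\<close>

lemma expectation_inner_sparsifier:
  assumes "prob_space M" and "valid_probs T p g" and "bernoulli_selectors M p b"
  shows "(\<integral>w. g \<bullet> sparsifier p b g w \<partial>M) = (norm g)\<^sup>2"
proof -
  have component: "(\<integral>w. g $ j * sparsifier p b g w $ j \<partial>M) = g $ j * g $ j" for j
  proof (cases "g $ j = 0")
    case False
    have "(\<integral>w. g $ j * sparsifier p b g w $ j \<partial>M)
        = (\<integral>w. g $ j * (g $ j / p $ j) * of_bool (b j w) \<partial>M)"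
      using False by (simp add: sparsifier_def mult.assoc)
    also have "\<dots> = g $ j * (g $ j / p $ j) * p $ j"
      by (simp only: integral_mult_right_zero expectation_bernoulli_selector[OF assms(2,3)])
    also have "\<dots> = g $ j * g $ j"
      using assms(2) False by (force simp: valid_probs_def)
    finally show ?thesis .
  qed simp
  have "(\<integral>w. g \<bullet> sparsifier p b g w \<partial>M)
      = (\<integral>w. (\<Sum>j\<in>UNIV. g $ j * sparsifier p b g w $ j) \<partial>M)"
    by (simp add: inner_vec_def)
  also have "\<dots> = (\<Sum>j\<in>UNIV. \<integral>w. g $ j * sparsifier p b g w $ j \<partial>M)"
    by (intro Bochner_Integration.integral_sum
        integrable_sparsifier[OF assms(1,3), where f = "\<lambda>q. g $ _ * q $ _"])
  also have "\<dots> = (norm g)\<^sup>2"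
    by (simp only: component power2_norm_eq_inner inner_vec_def inner_real_def)
  finally show ?thesis .
qed

text \<open>An unbiased vector has at least the second moment of its mean: take expectations in
  \<open>2 (g \<bullet> Q) \<le> \<parallel>g\<parallel>\<^sup>2 + \<parallel>Q\<parallel>\<^sup>2\<close>. Consequently the denominator of the sparsity ratio is positive
  when \<open>g \<noteq> 0\<close>.\<close>

lemma norm_squared_le_second_moment_sparsifier:
  assumes "prob_space M" and "valid_probs T p g" and "bernoulli_selectors M p b"
  shows "(norm g)\<^sup>2 \<le> (\<integral>w. (norm (sparsifier p b g w))\<^sup>2 \<partial>M)"
proof -
  interpret prob_space M by fact
  note int = integrable_sparsifier[OF assms(1,3)]
  have "2 * (norm g)\<^sup>2 = (\<integral>w. 2 * (g \<bullet> sparsifier p b g w) \<partial>M)"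
    by (simp add: expectation_inner_sparsifier[OF assms])
  also have "\<dots> \<le> (\<integral>w. (norm g)\<^sup>2 + (norm (sparsifier p b g w))\<^sup>2 \<partial>M)"
  proof (rule integral_mono)
    fix w
    show "2 * (g \<bullet> sparsifier p b g w) \<le> (norm g)\<^sup>2 + (norm (sparsifier p b g w))\<^sup>2"
      using zero_le_power2[of "norm (g - sparsifier p b g w)"]
      by (simp add: power2_norm_eq_inner inner_diff inner_commute)
  qed (rule int[where f = "\<lambda>q. 2 * (g \<bullet> q)"], rule int[where f = "\<lambda>q. (norm g)\<^sup>2 + (norm q)\<^sup>2"])
  also have "\<dots> = (norm g)\<^sup>2 + (\<integral>w. (norm (sparsifier p b g w))\<^sup>2 \<partial>M)"
    using int[where f = "\<lambda>q. (norm q)\<^sup>2"] by (simp add: prob_space)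
  finally show ?thesis by simp
qed

theorem lemma4:
  fixes F :: "real ^ 'n \<Rightarrow> real" and L T \<gamma> :: real and p x :: "real ^ 'n"
    and M :: "'w measure" and b :: "'n \<Rightarrow> 'w \<Rightarrow> bool" and x_plus :: "'w \<Rightarrow> real ^ 'n"
  assumes "L > 0"
    and "L_smooth L F"
    and "grad F x \<noteq> 0"
    and "prob_space M"
    and "valid_probs T p (grad F x)"
    and "bernoulli_selectors M p b"
    and "\<gamma> = sparsity_ratio M p b (grad F x) / L"
    and "\<And>w. w \<in> space M \<Longrightarrow> x_plus w = x - \<gamma> *\<^sub>R sparsifier p b (grad F x) w"
  shows "prob_space.expectation M (\<lambda>w. F (x_plus w)) \<le>
           prob_space.expectation M (\<lambda>w. F x)
           - sparsity_ratio M p b (grad F x) / (2 * L)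
             * prob_space.expectation M (\<lambda>w. (norm (grad F x))\<^sup>2)"
proof -
  interpret prob_space M by fact
  define g where "g = grad F x"
  define Q where "Q = sparsifier p b g"
  define S where "S = expectation (\<lambda>w. (norm (Q w))\<^sup>2)"
  have int: "integrable M (\<lambda>w. f (Q w))" for f :: "real ^ 'n \<Rightarrow> real"
    unfolding Q_def using assms(4,6) by (rule integrable_sparsifier)
  have mean: "expectation (\<lambda>w. g \<bullet> Q w) = (norm g)\<^sup>2"
    unfolding Q_def g_def by (rule expectation_inner_sparsifier[OF assms(4-6)])
  have "(norm g)\<^sup>2 \<le> S"
    unfolding S_def Q_def g_def by (rule norm_squared_le_second_moment_sparsifier[OF assms(4-6)])
  moreover have "0 < (norm g)\<^sup>2"
    using assms(3) by (simp add: g_def)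
  ultimately have S: "0 < S" by linarith
  have \<omega>: "sparsity_ratio M p b g = (norm g)\<^sup>2 / S"
    by (simp add: sparsity_ratio_def S_def Q_def)
  have \<gamma>: "\<gamma> = (norm g)\<^sup>2 / S / L"
    using assms(7) \<omega> by (simp add: g_def)
  have "expectation (\<lambda>w. F (x_plus w)) = expectation (\<lambda>w. F (x - \<gamma> *\<^sub>R Q w))"
    by (rule Bochner_Integration.integral_cong) (auto simp: assms(8) Q_def g_def)
  also have "\<dots> \<le> expectation (\<lambda>w. F x - \<gamma> * (g \<bullet> Q w) + L / 2 * \<gamma>\<^sup>2 * (norm (Q w))\<^sup>2)"
  proof (rule integral_mono)
    fix w
    show "F (x - \<gamma> *\<^sub>R Q w) \<le> F x - \<gamma> * (g \<bullet> Q w) + L / 2 * \<gamma>\<^sup>2 * (norm (Q w))\<^sup>2"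
      using L_smooth_quadratic_upper_bound[OF assms(2), of x "- (\<gamma> *\<^sub>R Q w)"]
      by (simp add: g_def power_mult_distrib mult.assoc)
  qed (rule int[of "\<lambda>q. F (x - \<gamma> *\<^sub>R q)"],
      rule int[of "\<lambda>q. F x - \<gamma> * (g \<bullet> q) + L / 2 * \<gamma>\<^sup>2 * (norm q)\<^sup>2"])
  also have "\<dots> = F x - \<gamma> * (norm g)\<^sup>2 + L / 2 * \<gamma>\<^sup>2 * S"
    using int[of "\<lambda>q. g \<bullet> q"] int[of "\<lambda>q. (norm q)\<^sup>2"]
    by (simp add: prob_space mean S_def)
  also have "\<dots> = F x - (norm g)\<^sup>2 / S / (2 * L) * (norm g)\<^sup>2"
    using S assms(1) by (simp add: \<gamma> field_simps power2_eq_square)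
  finally show ?thesis
    using \<omega> by (simp add: prob_space g_def)
qed

end
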